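(* Consider a network with node set $\mathcal V=\{o,d\}$ and two parallel links $\mathcal E=\{1,2\}$ from $o$ to $d$, with unit throughput. Assume the delay functions are $\tau_e(\theta_e,f_e)=f_e/\alpha_e+\theta_e$ with $\alpha_e>0$ for $e\in\mathcal E$, and that the system-optimum flow satisfies $f^*_e(\theta)>0$ for every $e\in\mathcal E$ and every $\theta\in\operatorname{supp}(\Theta)$. If $\Delta=\mathbf 0$, where $\Delta_{ij}=\mathbb E[\Theta_i-\Theta_j]$ for $i,j\in\mathcal E$, then the direct signaling rule $\pi^*=f^*$ is an optimal rule and $C(f^{\pi^*})=C(f^* )$.
   Context: A unit mass of users travels from $o$ to $d$; each link is a path. Let $\mathcal F=\{x\in\mathbb R_+^{\mathcal E}:\sum_ex_e=1\}$. The network state $\Theta$ is a random vector in $\mathbb R_+^{\mathcal E}$ with law denoted $\mathbb P$, whose entries have finite first and second moments; $\operatorname{supp}(\Theta)$ is the support of its law. The cost of a network flow $f:\mathbb R_+^{\mathcal E}\to\mathcal F$ is $C(f)=\mathbb E\big[\sum_ef_e(\Theta)\tau_e(\Theta_e,f_e(\Theta))\big]$. The system-optimum flow is $f^*(\theta)=\arg\min_{x\in\mathcal F}\sum_ex_e\tau_e(\theta_e,x_e)$ (unique). For a finite message set $\mathcal M$, a signaling rule is a measurable map $\pi:\mathbb R_+^{\mathcal E}\to\mathbb R_+^{\mathcal M}$ with $\sum_m\pi_m(\theta)=1$ for all $\theta$ ($\pi_m(\theta)$ is the fraction of users receiving message $m$ when $\Theta=\theta$). For $y\in\mathbb R_+^{\mathcal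 E\times\mathcal M}$ with $\sum_{e}y_{em}=1$ for every $m$, let $f^{\pi,y}(\theta)=y\pi(\theta)$. $f^{\pi,y}$ is a Bayesian Wardrop equilibrium (BWE) for $\pi$ if, whenever $y_{im}>0$, $\int\big(\tau_i(\theta_i,f_i^{\pi,y}(\theta))-\tau_j(\theta_j,f_j^{\pi,y}(\theta))\big)\pi_m(\theta)\,d\mathbb P(\theta)\le0$ for every $j\in\mathcal E$. Every rule $\pi$ has a BWE, unique up to $\mathbb P$-null sets of $\theta$, denoted $f^\pi$; $C(f^\pi)$ is the cost of the rule. A rule is optimal if it minimizes $C(f^\pi)$ over all finite message sets $\mathcal M$ and all rules with message set $\mathcal M$. $f^*$ is regarded as a signaling rule with message set $\mathcal M=\mathcal E$ (messages are link recommendations). *)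

theory Defs
  imports "HOL-Probability.Probability"
begin

text \<open>
  Links are the elements of a finite type \<open>'e\<close>. Every link joins the origin directly to the
  destination, so links are paths and the two nodes need no representation of their own.
  \<open>\<tau> e t x\<close> is the delay of link \<open>e\<close> in state \<open>t\<close> under flow \<open>x\<close>.
\<close>

definition state_space :: "(real ^ 'e) measure" where
  "state_space = restrict_space borel {\<theta>. \<forall>e. 0 \<le> \<theta> $ e}"

definition feasible_flows :: "(real ^ 'e::finite) set" where
  "feasible_flows = {x. (\<forall>e. 0 \<le> x $ e) \<and> (\<Sum>e\<in>UNIV. x $ e) = 1}"

definition law :: "'w measure \<Rightarrow> ('w \<Rightarrow> real ^ 'e) \<Rightarrow> (real ^ 'e) measure" where
  "law M \<Theta> = distr M state_space \<Theta>"

definition measure_support :: "'a::topological_space measure \<Rightarrow> 'a set" where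
  "measure_support P =
     {x \<in> space P. \<forall>U. open U \<longrightarrow> x \<in> U \<longrightarrow> 0 < emeasure P (U \<inter> space P)}"

definition total_delay ::
  "('e::finite \<Rightarrow> real \<Rightarrow> real \<Rightarrow> real) \<Rightarrow> real ^ 'e \<Rightarrow> real ^ 'e \<Rightarrow> real" where
  "total_delay \<tau> \<theta> x = (\<Sum>e\<in>UNIV. x $ e * \<tau> e (\<theta> $ e) (x $ e))"

definition flow_cost ::
  "'w measure \<Rightarrow> ('w \<Rightarrow> real ^ 'e) \<Rightarrow> ('e::finite \<Rightarrow> real \<Rightarrow> real \<Rightarrow> real)
    \<Rightarrow> (real ^ 'e \<Rightarrow> real ^ 'e) \<Rightarrow> real" where
  "flow_cost M \<Theta> \<tau> f = (\<integral>\<omega>. total_delay \<tau> (\<Theta> \<omega>) (f (\<Theta> \<omega>)) \<partial>M)"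

definition system_optimum ::
  "('e::finite \<Rightarrow> real \<Rightarrow> real \<Rightarrow> real) \<Rightarrow> real ^ 'e \<Rightarrow> real ^ 'e" where
  "system_optimum \<tau> \<theta> = arg_min_on (total_delay \<tau> \<theta>) feasible_flows"

definition signaling_rule :: "'m set \<Rightarrow> (real ^ 'e \<Rightarrow> 'm \<Rightarrow> real) \<Rightarrow> bool" where
  "signaling_rule Msg \<pi> \<longleftrightarrow>
     finite Msg \<and>
     (\<forall>m\<in>Msg. (\<lambda>\<theta>. \<pi> \<theta> m) \<in> borel_measurable state_space) \<and>
     (\<forall>\<theta>\<in>space state_space. (\<forall>m\<in>Msg. 0 \<le> \<pi> \<theta> m) \<and> (\<Sum>m\<in>Msg. \<pi> \<theta> m) = 1)"

definition message_response :: "'m set \<Rightarrow> ('e::finite \<Rightarrow> 'm \<Rightarrow> real) \<Rightarrow> bool" where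
  "message_response Msg y \<longleftrightarrow>
     (\<forall>m\<in>Msg. (\<forall>e. 0 \<le> y e m) \<and> (\<Sum>e\<in>UNIV. y e m) = 1)"

definition induced_flow ::
  "'m set \<Rightarrow> (real ^ 'e \<Rightarrow> 'm \<Rightarrow> real) \<Rightarrow> ('e \<Rightarrow> 'm \<Rightarrow> real) \<Rightarrow> real ^ 'e \<Rightarrow> real ^ 'e" where
  "induced_flow Msg \<pi> y \<theta> = (\<chi> e. \<Sum>m\<in>Msg. y e m * \<pi> \<theta> m)"

text \<open>Bayesian Wardrop equilibria, identified by the message response that induces the flow.\<close>

definition bayesian_wardrop_equilibrium ::
  "'w measure \<Rightarrow> ('w \<Rightarrow> real ^ 'e) \<Rightarrow> ('e::finite \<Rightarrow> real \<Rightarrow> real \<Rightarrow> real)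
    \<Rightarrow> 'm set \<Rightarrow> (real ^ 'e \<Rightarrow> 'm \<Rightarrow> real) \<Rightarrow> ('e \<Rightarrow> 'm \<Rightarrow> real) \<Rightarrow> bool" where
  "bayesian_wardrop_equilibrium M \<Theta> \<tau> Msg \<pi> y \<longleftrightarrow>
     message_response Msg y \<and>
     (\<forall>i. \<forall>m\<in>Msg. 0 < y i m \<longrightarrow>
       (\<forall>j. (\<integral>\<theta>. (\<tau> i (\<theta> $ i) (induced_flow Msg \<pi> y \<theta> $ i)
                   - \<tau> j (\<theta> $ j) (induced_flow Msg \<pi> y \<theta> $ j)) * \<pi> \<theta> m \<partial>law M \<Theta>) \<le> 0))"

text \<open>
  The cost of a rule is the cost of its equilibrium flow, which is only determined up to null
  sets. Instead of selecting one equilibrium, optimality requires that the rule has an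
  equilibrium and that each of its equilibria costs at most as much as any equilibrium of any
  competing rule. The competing message sets are the finite sets over the type \<open>'n\<close>; a statement
  that is polymorphic in \<open>'n\<close> thus covers all finite message sets.
\<close>

definition optimal_rule ::
  "'n itself \<Rightarrow> 'w measure \<Rightarrow> ('w \<Rightarrow> real ^ 'e) \<Rightarrow> ('e::finite \<Rightarrow> real \<Rightarrow> real \<Rightarrow> real)
    \<Rightarrow> 'm set \<Rightarrow> (real ^ 'e \<Rightarrow> 'm \<Rightarrow> real) \<Rightarrow> bool" where
  "optimal_rule _ M \<Theta> \<tau> Msg \<pi> \<longleftrightarrow>
     signaling_rule Msg \<pi> \<and>
     (\<exists>y. bayesian_wardrop_equilibrium M \<Theta> \<tau> Msg \<pi> y) \<and>
     (\<forall>y. bayesian_wardrop_equilibrium M \<Theta> \<tau> Msg \<pi> y \<longrightarrow>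
       (\<forall>(Msg' :: 'n set) \<pi>' y'.
          signaling_rule Msg' \<pi>' \<longrightarrow> bayesian_wardrop_equilibrium M \<Theta> \<tau> Msg' \<pi>' y' \<longrightarrow>
          flow_cost M \<Theta> \<tau> (induced_flow Msg \<pi> y)
            \<le> flow_cost M \<Theta> \<tau> (induced_flow Msg' \<pi>' y')))"

text \<open>A flow regarded as a signaling rule whose messages are the recommended links.\<close>

definition direct_rule :: "(real ^ 'e \<Rightarrow> real ^ 'e) \<Rightarrow> real ^ 'e \<Rightarrow> 'e \<Rightarrow> real" where
  "direct_rule f \<theta> e = f \<theta> $ e"

end

theory Submission imports Defs begin

text \<open>
  Put \<open>D = \<theta>\<^sub>1 - \<theta>\<^sub>2\<close> and \<open>s = 1/\<alpha>\<^sub>1 + 1/\<alpha>\<^sub>2\<close>. Where the optimum is interior, \<open>f\<^sub>1\<^sup>* = (1/\<alpha>\<^sub>2)/s - D/(2s)\<close>, and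
  under \<open>f\<^sup>*\<close> link 1 is slower than link 2 by exactly \<open>D/2\<close>. Since \<open>E D = 0\<close>, this gives
  \<open>E[D f\<^sub>1\<^sup>*] = - E[D\<^sup>2]/(2s) \<le> 0\<close> and \<open>E[D f\<^sub>2\<^sup>*] = - E[D f\<^sub>1\<^sup>*] \<ge> 0\<close>, so obeying the recommendations is an
  equilibrium, and it induces \<open>f\<^sup>*\<close>. Equilibria satisfy a variational inequality that is strictly
  monotone in the flow, so every other equilibrium of the rule induces the same flow almost surely.
  No rule beats the pointwise optimum \<open>f\<^sup>*\<close>.
\<close>

section \<open>The support carries the full measure\<close>

text \<open>A point outside the support lies in a null basic open set, and a countable basis
  supplies only countably many of these. The assumption leaves room for measures living on a subset
  of the space, such as \<open>law M \<Theta>\<close>.\<close>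

lemma AE_in_measure_support:
  fixes P :: "'a::second_countable_topology measure"
  assumes "\<And>U. open U \<Longrightarrow> U \<inter> space P \<in> sets P"
  shows "AE x in P. x \<in> measure_support P"
proof -
  obtain B :: "'a set set" where B: "countable B" "topological_basis B"
    using ex_countable_basis by blast
  define N where "N = {U \<in> B. emeasure P (U \<inter> space P) = 0}"
  have avoids: "AE x in P. \<forall>U\<in>N. x \<notin> U \<inter> space P"
  proof (subst AE_ball_countable)
    show "countable N"
      using B(1) by (simp add: N_def)
    show "\<forall>U\<in>N. AE x in P. x \<notin> U \<inter> space P"
      using B(2) assms by (intro ballI AE_not_in null_setsI) (auto simp: N_def topological_basis_open)
  qed
  have support: "x \<in> measure_support P" if "\<forall>U\<in>N. x \<notin> U \<inter> space P" "x \<in> space P" for x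
    unfolding measure_support_def
  proof (intro CollectI conjI allI impI)
    fix U assume U: "open U" "x \<in> U"
    then obtain V where V: "V \<in> B" "x \<in> V" "V \<subseteq> U"
      using B(2) by (meson topological_basisE)
    with that have "emeasure P (V \<inter> space P) \<noteq> 0"
      by (auto simp: N_def)
    moreover have "emeasure P (V \<inter> space P) \<le> emeasure P (U \<inter> space P)"
      using V U by (intro emeasure_mono assms) auto
    ultimately show "0 < emeasure P (U \<inter> space P)"
      by (metis gr_zeroI le_zero_eq)
  qed (use that in auto)
  show ?thesis
    using avoids AE_space by eventually_elim (rule support)
qed

section \<open>Feasibility and boundedness of flows and message weights\<close>

lemma state_component_measurable [measurable]:
  "(\<lambda>\<theta>::real ^ 'e::finite. \<theta> $ e) \<in> borel_measurable state_space"
  unfolding state_space_def by (intro measurable_restrict_space1) simp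

text \<open>Nothing is required outside \<open>state_space\<close>, because signaling rules are
  unconstrained there.\<close>

definition feasible_rule :: "(real ^ 'e \<Rightarrow> real ^ 'e::finite) \<Rightarrow> bool" where
  "feasible_rule g \<longleftrightarrow> (\<forall>e. (\<lambda>\<theta>. g \<theta> $ e) \<in> borel_measurable state_space) \<and>
     (\<forall>\<theta>\<in>space state_space. g \<theta> \<in> feasible_flows)"

lemma feasible_component:
  fixes x :: "real ^ 'e::finite"
  assumes "x \<in> feasible_flows"
  shows "0 \<le> x $ e" "x $ e \<le> 1"
proof -
  show "0 \<le> x $ e"
    using assms by (simp add: feasible_flows_def)
  have "x $ e \<le> (\<Sum>e\<in>UNIV. x $ e)"
    using assms by (intro member_le_sum) (auto simp: feasible_flows_def)
  then show "x $ e \<le> 1"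
    using assms by (simp add: feasible_flows_def)
qed

text \<open>After swapping the sums, the total flow is the average of the masses of the responses,
  each equal to 1, weighted by the message fractions.\<close>

lemma induced_flow_feasible:
  fixes \<pi> :: "real ^ 'e::finite \<Rightarrow> 'm \<Rightarrow> real"
  assumes "signaling_rule Msg \<pi>" "message_response Msg y"
  shows "feasible_rule (induced_flow Msg \<pi> y)"
  unfolding feasible_rule_def
proof (intro conjI allI ballI)
  fix e
  show "(\<lambda>\<theta>. induced_flow Msg \<pi> y \<theta> $ e) \<in> borel_measurable state_space"
    using assms unfolding induced_flow_def signaling_rule_def
    by (auto intro!: borel_measurable_sum borel_measurable_times)
next
  fix \<theta> :: "real ^ 'e" assume \<theta>: "\<theta> \<in> space state_space"
  have "(\<Sum>e\<in>UNIV. \<Sum>m\<in>Msg. y e m * \<pi> \<theta> m) = (\<Sum>m\<in>Msg. (\<Sum>e\<in>UNIV. y e m) * \<pi> \<theta> m)"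
    by (subst sum.swap) (simp add: sum_distrib_right)
  also have "\<dots> = 1"
    using assms \<theta> by (simp add: message_response_def signaling_rule_def)
  finally show "induced_flow Msg \<pi> y \<theta> \<in> feasible_flows"
    using assms \<theta>
    by (auto simp: feasible_flows_def induced_flow_def message_response_def signaling_rule_def
        intro!: sum_nonneg)
qed

lemma feasible_rule_component:
  assumes "feasible_rule g"
  shows "(\<lambda>\<theta>. g \<theta> $ e) \<in> borel_measurable state_space"
    and "\<theta> \<in> space state_space \<Longrightarrow> \<bar>g \<theta> $ e\<bar> \<le> 1"
  using assms feasible_component[of "g \<theta>" e] by (auto simp: feasible_rule_def)

lemma message_weight:
  assumes "signaling_rule Msg \<pi>" "m \<in> Msg" "\<theta> \<in> space state_space"
  shows "0 \<le> \<pi> \<theta> m" "\<pi> \<theta> m \<le> 1"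
proof -
  show "0 \<le> \<pi> \<theta> m"
    using assms by (simp add: signaling_rule_def)
  have "\<pi> \<theta> m \<le> (\<Sum>m\<in>Msg. \<pi> \<theta> m)"
    using assms by (intro member_le_sum) (auto simp: signaling_rule_def)
  then show "\<pi> \<theta> m \<le> 1"
    using assms by (simp add: signaling_rule_def)
qed

definition obedience :: "'e \<Rightarrow> 'e \<Rightarrow> real" where
  "obedience e m = (if e = m then 1 else 0)"

section \<open>Integrability for affine delays on finitely many parallel links\<close>

locale affine_network = prob_space M for M :: "'w measure" +
  fixes \<Theta> :: "'w \<Rightarrow> real ^ 'e::finite"
    and \<tau> :: "'e \<Rightarrow> real \<Rightarrow> real \<Rightarrow> real"
    and \<alpha> :: "'e \<Rightarrow> real"
  assumes state_measurable [measurable]: "\<Theta> \<in> measurable M state_space"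
    and state_integrable: "\<And>e. integrable M (\<lambda>\<omega>. \<Theta> \<omega> $ e)"
    and capacity_pos: "\<And>e. 0 < \<alpha> e"
    and delay: "\<And>e t x. \<tau> e t x = x / \<alpha> e + t"
begin

lemma state_in_space: "\<omega> \<in> space M \<Longrightarrow> \<Theta> \<omega> \<in> space state_space"
  using state_measurable by (rule measurable_space)

text \<open>Domination by \<open>B * \<bar>h \<omega>\<bar>\<close>. Flows and message weights play
  the role of the bounded factor \<open>k\<close>, so first moments of the state control all the
  expectations that follow.\<close>

lemma integrable_bounded_mult:
  fixes k :: "real ^ 'e \<Rightarrow> real" and h :: "'w \<Rightarrow> real"
  assumes "k \<in> borel_measurable state_space" "\<And>\<theta>. \<theta> \<in> space state_space \<Longrightarrow> \<bar>k \<theta>\<bar> \<le> B"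
    and "integrable M h"
  shows "integrable M (\<lambda>\<omega>. h \<omega> * k (\<Theta> \<omega>))"
proof (rule Bochner_Integration.integrable_bound)
  show "integrable M (\<lambda>\<omega>. B * \<bar>h \<omega>\<bar>)"
    using assms(3) by simp
  have "h \<in> borel_measurable M" "(\<lambda>\<omega>. k (\<Theta> \<omega>)) \<in> borel_measurable M"
    using assms by auto
  then show "(\<lambda>\<omega>. h \<omega> * k (\<Theta> \<omega>)) \<in> borel_measurable M"
    by measurable
  show "AE \<omega> in M. norm (h \<omega> * k (\<Theta> \<omega>)) \<le> norm (B * \<bar>h \<omega>\<bar>)"
  proof (rule AE_I2)
    fix \<omega> assume "\<omega> \<in> space M"
    then have "\<bar>k (\<Theta> \<omega>)\<bar> \<le> \<bar>B\<bar>"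
      using assms(2)[OF state_in_space] by fastforce
    then have "\<bar>k (\<Theta> \<omega>)\<bar> * \<bar>h \<omega>\<bar> \<le> \<bar>B\<bar> * \<bar>h \<omega>\<bar>"
      by (intro mult_right_mono) auto
    then show "norm (h \<omega> * k (\<Theta> \<omega>)) \<le> norm (B * \<bar>h \<omega>\<bar>)"
      by (simp add: abs_mult mult.commute[of "\<bar>h \<omega>\<bar>"])
  qed
qed

lemma integrable_delay:
  assumes "feasible_rule g"
  shows "integrable M (\<lambda>\<omega>. \<tau> e (\<Theta> \<omega> $ e) (g (\<Theta> \<omega>) $ e))"
proof -
  \<comment> \<open>Here \<open>h\<close> is the constant \<open>1 / \<alpha> e\<close>, integrable
    under a probability measure.\<close>
  have "integrable M (\<lambda>\<omega>. 1 / \<alpha> e * (g (\<Theta> \<omega>) $ e))"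
    by (rule integrable_bounded_mult[OF feasible_rule_component[OF assms]]) simp_all
  then show ?thesis
    using state_integrable[of e] unfolding delay by simp
qed

lemma integrable_delay_mult:
  assumes "feasible_rule g" "k \<in> borel_measurable state_space"
    and "\<And>\<theta>. \<theta> \<in> space state_space \<Longrightarrow> \<bar>k \<theta>\<bar> \<le> B"
  shows "integrable M (\<lambda>\<omega>. \<tau> e (\<Theta> \<omega> $ e) (g (\<Theta> \<omega>) $ e) * k (\<Theta> \<omega>))"
  by (rule integrable_bounded_mult[OF assms(2,3) integrable_delay[OF assms(1)]])

lemma integrable_total_delay:
  assumes "feasible_rule g"
  shows "integrable M (\<lambda>\<omega>. total_delay \<tau> (\<Theta> \<omega>) (g (\<Theta> \<omega>)))"
proof -
  have "integrable M (\<lambda>\<omega>. \<tau> e (\<Theta> \<omega> $ e) (g (\<Theta> \<omega>) $ e) * g (\<Theta> \<omega>) $ e)" for e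
    by (rule integrable_delay_mult[OF assms feasible_rule_component[OF assms]])
  then show ?thesis
    unfolding total_delay_def by (simp add: mult.commute)
qed

section \<open>Equilibria as a variational inequality, and uniqueness of the flow\<close>

text \<open>The conditional expected delay given the message, multiplied by the expected fraction of
  its recipients. Without normalization, messages of mass zero need no separate case.\<close>

definition message_delay :: "'m set \<Rightarrow> (real ^ 'e \<Rightarrow> 'm \<Rightarrow> real) \<Rightarrow> ('e \<Rightarrow> 'm \<Rightarrow> real)
    \<Rightarrow> 'e \<Rightarrow> 'm \<Rightarrow> real" where
  "message_delay Msg \<pi> y e m =
     (\<integral>\<omega>. \<tau> e (\<Theta> \<omega> $ e) (induced_flow Msg \<pi> y (\<Theta> \<omega>) $ e) * \<pi> (\<Theta> \<omega>) m \<partial>M)"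

lemma integrable_message_delay:
  assumes "signaling_rule Msg \<pi>" "message_response Msg y" "m \<in> Msg"
  shows "integrable M (\<lambda>\<omega>. \<tau> e (\<Theta> \<omega> $ e) (induced_flow Msg \<pi> y (\<Theta> \<omega>) $ e) * \<pi> (\<Theta> \<omega>) m)"
proof (rule integrable_delay_mult[where k = "\<lambda>\<theta>. \<pi> \<theta> m"])
  show "feasible_rule (induced_flow Msg \<pi> y)"
    using assms by (intro induced_flow_feasible)
  show "(\<lambda>\<theta>. \<pi> \<theta> m) \<in> borel_measurable state_space"
    using assms by (simp add: signaling_rule_def)
  show "\<bar>\<pi> \<theta> m\<bar> \<le> 1" if "\<theta> \<in> space state_space" for \<theta>
    using message_weight[OF assms(1,3) that] by simp
qed

text \<open>Integrability lets the integral of the difference split, so each link gets its own cost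
  per message and the links in use are those of minimal cost.\<close>

lemma bayesian_wardrop_equilibrium_iff:
  assumes "signaling_rule Msg \<pi>"
  shows "bayesian_wardrop_equilibrium M \<Theta> \<tau> Msg \<pi> y \<longleftrightarrow> message_response Msg y \<and>
    (\<forall>i. \<forall>m\<in>Msg. 0 < y i m \<longrightarrow> (\<forall>j. message_delay Msg \<pi> y i m \<le> message_delay Msg \<pi> y j m))"
proof -
  have "(\<integral>\<theta>. (\<tau> i (\<theta> $ i) (induced_flow Msg \<pi> y \<theta> $ i)
                   - \<tau> j (\<theta> $ j) (induced_flow Msg \<pi> y \<theta> $ j)) * \<pi> \<theta> m \<partial>law M \<Theta>)
      = message_delay Msg \<pi> y i m - message_delay Msg \<pi> y j m"
    if y: "message_response Msg y" and m: "m \<in> Msg" for i j m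
  proof -
    have [measurable]: "(\<lambda>\<theta>. \<pi> \<theta> m) \<in> borel_measurable state_space"
      "\<And>e. (\<lambda>\<theta>. induced_flow Msg \<pi> y \<theta> $ e) \<in> borel_measurable state_space"
      using assms m induced_flow_feasible[OF assms y]
      by (auto simp: signaling_rule_def feasible_rule_def)
    show ?thesis
      unfolding law_def message_delay_def
      using integrable_message_delay[OF assms y m]
      by (subst integral_distr) (simp_all add: delay left_diff_distrib)
  qed
  then show ?thesis
    unfolding bayesian_wardrop_equilibrium_def by auto
qed

text \<open>For each message, \<open>y\<close> uses only cheapest links at the costs it creates, so
  no other response \<open>z\<close> is cheaper at these fixed costs.\<close>

lemma equilibrium_variational_inequality:
  assumes "signaling_rule Msg \<pi>" "bayesian_wardrop_equilibrium M \<Theta> \<tau> Msg \<pi> y"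
    and "message_response Msg z"
  shows "(\<Sum>e\<in>UNIV. \<Sum>m\<in>Msg. (y e m - z e m) * message_delay Msg \<pi> y e m) \<le> 0"
proof -
  let ?c = "message_delay Msg \<pi> y"
  have y: "message_response Msg y"
    and eq: "\<And>i j m. m \<in> Msg \<Longrightarrow> 0 < y i m \<Longrightarrow> ?c i m \<le> ?c j m"
    using assms by (auto simp: bayesian_wardrop_equilibrium_iff)
  have "(\<Sum>e\<in>UNIV. (y e m - z e m) * ?c e m) \<le> 0" if m: "m \<in> Msg" for m
  proof -
    have sums: "(\<Sum>e\<in>UNIV. y e m) = 1" "(\<Sum>e\<in>UNIV. z e m) = 1"
      and nonneg: "\<And>e. 0 \<le> y e m" "\<And>e. 0 \<le> z e m"
      using y assms(3) m by (auto simp: message_response_def)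
    obtain i where i: "0 < y i m"
      using sums(1) nonneg(1) by (metis less_eq_real_def sum.neutral zero_neq_one)
    \<comment> \<open>Both responses have mass 1, so the minimal cost \<open>?c i m\<close> may be
      subtracted. Then a link used by \<open>y\<close> contributes 0, and on any other link the
      first factor is at most 0 and the second at least 0.\<close>
    have "(\<Sum>e\<in>UNIV. (y e m - z e m) * ?c e m)
        = (\<Sum>e\<in>UNIV. (y e m - z e m) * (?c e m - ?c i m))"
      by (simp add: right_diff_distrib sum_subtractf sums flip: sum_distrib_right)
    also have "\<dots> \<le> 0"
    proof (rule sum_nonpos)
      fix e
      show "(y e m - z e m) * (?c e m - ?c i m) \<le> 0"
      proof (cases "0 < y e m")
        case True
        then show ?thesis
          using eq[OF m True, of i] eq[OF m i, of e] by simp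
      next
        case False
        then show ?thesis
          using eq[OF m i, of e] nonneg[of e] by (intro mult_nonpos_nonneg) auto
      qed
    qed
    finally show ?thesis .
  qed
  then show ?thesis
    by (subst sum.swap) (rule sum_nonpos)
qed

text \<open>Linearity in \<open>z\<close> carries the variational inequality from responses to
  flows: the weighted message delays become the expected cost of sending the flow of
  \<open>z\<close> through the delays created by \<open>y\<close>.\<close>

lemma
  assumes "signaling_rule Msg \<pi>" "message_response Msg y" "message_response Msg z"
  defines "f \<equiv> \<lambda>\<omega>. \<Sum>e\<in>UNIV. \<tau> e (\<Theta> \<omega> $ e) (induced_flow Msg \<pi> y (\<Theta> \<omega>) $ e)
      * induced_flow Msg \<pi> z (\<Theta> \<omega>) $ e"
  shows sum_message_delay:
      "(\<Sum>e\<in>UNIV. \<Sum>m\<in>Msg. z e m * message_delay Msg \<pi> y e m) = integral\<^sup>L M f"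
    and integrable_sum_delay: "integrable M f"
proof -
  have f: "f = (\<lambda>\<omega>. \<Sum>e\<in>UNIV. \<Sum>m\<in>Msg. z e m *
      (\<tau> e (\<Theta> \<omega> $ e) (induced_flow Msg \<pi> y (\<Theta> \<omega>) $ e) * \<pi> (\<Theta> \<omega>) m))"
    by (simp add: f_def induced_flow_def[of Msg \<pi> z] sum_distrib_left mult.left_commute)
  note int = integrable_message_delay[OF assms(1,2)]
  show "integrable M f"
    unfolding f by (intro Bochner_Integration.integrable_sum integrable_mult_right int)
  show "(\<Sum>e\<in>UNIV. \<Sum>m\<in>Msg. z e m * message_delay Msg \<pi> y e m) = integral\<^sup>L M f"
    unfolding f by (simp add: message_delay_def int)
qed

text \<open>Test each equilibrium against the other and add the two inequalities. By strict
  monotonicity of the delays, the expected weighted square distance of the flows vanishes. The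
  responses themselves may still differ.\<close>

lemma equilibrium_flow_unique:
  assumes \<pi>: "signaling_rule Msg \<pi>"
    and y: "bayesian_wardrop_equilibrium M \<Theta> \<tau> Msg \<pi> y"
    and z: "bayesian_wardrop_equilibrium M \<Theta> \<tau> Msg \<pi> z"
  shows "AE \<omega> in M. induced_flow Msg \<pi> y (\<Theta> \<omega>) = induced_flow Msg \<pi> z (\<Theta> \<omega>)"
proof -
  define g where "g = induced_flow Msg \<pi> y"
  define h where "h = induced_flow Msg \<pi> z"
  have yr: "message_response Msg y" and zr: "message_response Msg z"
    using y z by (auto simp: bayesian_wardrop_equilibrium_def)
  \<comment> \<open>Traffic \<open>l\<close> is charged the delays that flow \<open>k\<close>
    creates.\<close>
  define F where "F k l \<omega> = (\<Sum>e\<in>UNIV. \<tau> e (\<Theta> \<omega> $ e) (k (\<Theta> \<omega>) $ e) * l (\<Theta> \<omega>) $ e)"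
    for k l :: "real ^ 'e \<Rightarrow> real ^ 'e" and \<omega>
  define G where "G \<omega> = (\<Sum>e\<in>UNIV. (g (\<Theta> \<omega>) $ e - h (\<Theta> \<omega>) $ e)\<^sup>2 / \<alpha> e)" for \<omega>
  note expand = sum_message_delay[OF \<pi>] integrable_sum_delay[OF \<pi>]
  have int: "integrable M (F g g)" "integrable M (F g h)" "integrable M (F h g)" "integrable M (F h h)"
    using expand(2)[OF yr yr] expand(2)[OF yr zr] expand(2)[OF zr yr] expand(2)[OF zr zr]
    by (simp_all add: F_def[abs_def] g_def h_def)
  \<comment> \<open>The state terms of the affine delays cancel, and only the slopes
    \<open>1 / \<alpha> e\<close> remain.\<close>
  have G: "G = (\<lambda>\<omega>. F g g \<omega> - F g h \<omega> + (F h h \<omega> - F h g \<omega>))"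
  proof
    fix \<omega>
    show "G \<omega> = F g g \<omega> - F g h \<omega> + (F h h \<omega> - F h g \<omega>)"
      unfolding G_def F_def delay sum_subtractf[symmetric] sum.distrib[symmetric]
      by (intro sum.cong refl) (simp add: power2_eq_square diff_divide_distrib add_divide_distrib algebra_simps)
  qed
  have "integral\<^sup>L M (F g g) - integral\<^sup>L M (F g h) \<le> 0"
    using equilibrium_variational_inequality[OF \<pi> y zr] expand(1)[OF yr yr] expand(1)[OF yr zr]
    by (simp add: left_diff_distrib sum_subtractf F_def[abs_def] g_def h_def)
  moreover have "integral\<^sup>L M (F h h) - integral\<^sup>L M (F h g) \<le> 0"
    using equilibrium_variational_inequality[OF \<pi> z yr] expand(1)[OF zr yr] expand(1)[OF zr zr]
    by (simp add: left_diff_distrib sum_subtractf F_def[abs_def] g_def h_def)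
  ultimately have "integral\<^sup>L M G \<le> 0"
    using int by (simp add: G)
  moreover have G_nonneg: "0 \<le> G \<omega>" for \<omega>
    using capacity_pos by (auto simp: G_def less_imp_le intro!: sum_nonneg divide_nonneg_nonneg)
  ultimately have "integral\<^sup>L M G = 0"
    by (intro antisym integral_nonneg) auto
  moreover have "integrable M G"
    using int by (simp add: G)
  ultimately have "AE \<omega> in M. G \<omega> = 0"
    using G_nonneg by (subst (asm) integral_nonneg_eq_0_iff_AE) auto
  moreover have "g (\<Theta> \<omega>) = h (\<Theta> \<omega>)" if "G \<omega> = 0" for \<omega>
  proof -
    have "\<forall>e\<in>UNIV. (g (\<Theta> \<omega>) $ e - h (\<Theta> \<omega>) $ e)\<^sup>2 / \<alpha> e = 0"
      using that capacity_pos unfolding G_def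
      by (subst (asm) sum_nonneg_eq_0_iff) (auto simp: less_imp_le)
    then show ?thesis
      using capacity_pos by (auto simp: vec_eq_iff less_le)
  qed
  ultimately show ?thesis
    unfolding g_def h_def by (auto elim: eventually_mono)
qed

lemma flow_cost_cong_AE:
  assumes "feasible_rule g" "feasible_rule h" "AE \<omega> in M. g (\<Theta> \<omega>) = h (\<Theta> \<omega>)"
  shows "flow_cost M \<Theta> \<tau> g = flow_cost M \<Theta> \<tau> h"
  unfolding flow_cost_def
proof (rule integral_cong_AE)
  show "AE \<omega> in M. total_delay \<tau> (\<Theta> \<omega>) (g (\<Theta> \<omega>)) = total_delay \<tau> (\<Theta> \<omega>) (h (\<Theta> \<omega>))"
    using assms(3) by eventually_elim simp
qed (use assms in \<open>blast intro: borel_measurable_integrable integrable_total_delay\<close>)+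

lemma equilibrium_cost_unique:
  assumes "signaling_rule Msg \<pi>"
    and "bayesian_wardrop_equilibrium M \<Theta> \<tau> Msg \<pi> y"
    and "bayesian_wardrop_equilibrium M \<Theta> \<tau> Msg \<pi> z"
  shows "flow_cost M \<Theta> \<tau> (induced_flow Msg \<pi> y) = flow_cost M \<Theta> \<tau> (induced_flow Msg \<pi> z)"
proof -
  have "message_response Msg y" "message_response Msg z"
    using assms by (auto simp: bayesian_wardrop_equilibrium_def)
  then show ?thesis
    using assms by (intro flow_cost_cong_AE induced_flow_feasible equilibrium_flow_unique)
qed

text \<open>Makes a property assumed only on the support available under almost sure
  integrals.\<close>

lemma AE_state_in_support: "AE \<omega> in M. \<Theta> \<omega> \<in> measure_support (law M \<Theta>)"
proof -
  have "AE \<theta> in law M \<Theta>. \<theta> \<in> measure_support (law M \<Theta>)"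
  proof (rule AE_in_measure_support)
    fix U :: "(real ^ 'e) set" assume "open U"
    then show "U \<inter> space (law M \<Theta>) \<in> sets (law M \<Theta>)"
      by (auto simp: law_def state_space_def sets_restrict_space space_restrict_space)
  qed
  then show ?thesis
    unfolding law_def by (rule AE_distrD[OF state_measurable])
qed

end

section \<open>The system optimum on two links in closed form\<close>

locale affine_two_links = affine_network M \<Theta> \<tau> \<alpha>
  for M :: "'w measure" and \<Theta> :: "'w \<Rightarrow> real ^ 2" and \<tau> \<alpha>
begin

text \<open>With \<open>x $ 2 = 1 - x $ 1\<close> the total delay is a quadratic in
  \<open>x $ 1\<close>; this is its minimizer over all reals.\<close>

definition unconstrained_optimum :: "real ^ 2 \<Rightarrow> real" where
  "unconstrained_optimum \<theta> = (2 / \<alpha> 2 + \<theta> $ 2 - \<theta> $ 1) / (2 * (1 / \<alpha> 1 + 1 / \<alpha> 2))"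

text \<open>The projection onto the unit interval. Interiority is known only on the support, whereas
  a signaling rule must be feasible in every state.\<close>

definition optimal_share :: "real ^ 2 \<Rightarrow> real" where
  "optimal_share \<theta> = max 0 (min 1 (unconstrained_optimum \<theta>))"

lemma slope_pos: "0 < 1 / \<alpha> 1 + 1 / \<alpha> 2"
  using capacity_pos by (simp add: add_pos_pos)

lemma unconstrained_optimum_stationary:
  "2 * ((1 / \<alpha> 1 + 1 / \<alpha> 2) * unconstrained_optimum \<theta>) = 2 / \<alpha> 2 + \<theta> $ 2 - \<theta> $ 1"
proof -
  have "2 * (s * (n / (2 * s))) = n" if "0 < s" for s n :: real
    using that by simp
  then show ?thesis
    unfolding unconstrained_optimum_def using slope_pos .
qed

text \<open>Completing the square; the constant term of the quadratic cancels in the difference.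
  Minimizing delay thus means minimizing the distance of \<open>x $ 1\<close> to
  \<open>unconstrained_optimum \<theta>\<close>.\<close>

lemma total_delay_eq:
  assumes "x \<in> feasible_flows" "y \<in> feasible_flows"
  shows "total_delay \<tau> \<theta> x - total_delay \<tau> \<theta> y = (1 / \<alpha> 1 + 1 / \<alpha> 2) *
     ((x $ 1 - unconstrained_optimum \<theta>)\<^sup>2 - (y $ 1 - unconstrained_optimum \<theta>)\<^sup>2)"
proof -
  define a b where "a = 1 / \<alpha> 1" and "b = 1 / \<alpha> 2"
  define c where "c = unconstrained_optimum \<theta>"
  have xy: "x $ 2 = 1 - x $ 1" "y $ 2 = 1 - y $ 1"
    using assms by (auto simp: feasible_flows_def sum_2)
  have c: "2 * ((a + b) * c) = 2 * b + \<theta> $ 2 - \<theta> $ 1"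
    using unconstrained_optimum_stationary by (simp add: a_def b_def c_def)
  have "total_delay \<tau> \<theta> x - total_delay \<tau> \<theta> y
     = (a + b) * ((x $ 1)\<^sup>2 - (y $ 1)\<^sup>2) - (2 * b + \<theta> $ 2 - \<theta> $ 1) * (x $ 1 - y $ 1)"
    by (simp add: total_delay_def sum_2 delay xy a_def b_def power2_eq_square field_simps)
      (use capacity_pos[of 1] capacity_pos[of 2] in \<open>simp add: field_simps\<close>)
  also have "\<dots> = (a + b) * ((x $ 1 - c)\<^sup>2 - (y $ 1 - c)\<^sup>2)"
    unfolding c[symmetric] by (simp add: power2_eq_square algebra_simps)
  finally show ?thesis
    by (simp add: a_def b_def c_def)
qed

lemma optimal_share_closest:
  assumes "0 \<le> x" "x \<le> 1" "x \<noteq> optimal_share \<theta>"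
  shows "(optimal_share \<theta> - unconstrained_optimum \<theta>)\<^sup>2 < (x - unconstrained_optimum \<theta>)\<^sup>2"
proof -
  let ?c = "unconstrained_optimum \<theta>"
  \<comment> \<open>The vertex of the parabola lies left of the unit interval, right of it, or
    inside it.\<close>
  consider "?c < 0" "optimal_share \<theta> = 0" | "1 < ?c" "optimal_share \<theta> = 1" | "optimal_share \<theta> = ?c"
    unfolding optimal_share_def by linarith
  then have "\<bar>optimal_share \<theta> - ?c\<bar> < \<bar>x - ?c\<bar>"
    using assms by cases linarith+
  then show ?thesis
    using abs_le_square_iff[of "x - ?c" "optimal_share \<theta> - ?c"] by linarith
qed

text \<open>\<open>arg_min_on\<close> chooses some minimizer, so identifying it requires
  \<open>?x\<close> to beat every other feasible flow strictly.\<close>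

lemma system_optimum_eq:
  "system_optimum \<tau> \<theta> = (\<chi> e. if e = 1 then optimal_share \<theta> else 1 - optimal_share \<theta>)"
    (is "_ = ?x")
proof -
  have x: "?x \<in> feasible_flows"
    by (auto simp: feasible_flows_def sum_2 optimal_share_def)
  have less: "total_delay \<tau> \<theta> ?x < total_delay \<tau> \<theta> y" if "y \<in> feasible_flows" "y \<noteq> ?x" for y
  proof -
    have y: "0 \<le> y $ 1" "y $ 1 \<le> 1" "y $ 2 = 1 - y $ 1"
      using that(1) by (auto simp: feasible_flows_def sum_2 forall_2)
    then have "y $ 1 \<noteq> optimal_share \<theta>"
      using that(2) by (auto simp: vec_eq_iff forall_2)
    then have "(optimal_share \<theta> - unconstrained_optimum \<theta>)\<^sup>2 < (y $ 1 - unconstrained_optimum \<theta>)\<^sup>2"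
      using y by (intro optimal_share_closest) auto
    then have "total_delay \<tau> \<theta> ?x - total_delay \<tau> \<theta> y < 0"
      unfolding total_delay_eq[OF x that(1)] using slope_pos by (intro mult_pos_neg) auto
    then show ?thesis by simp
  qed
  show ?thesis
    unfolding system_optimum_def arg_min_on_def
    by (rule arg_minI[of _ ?x]) (use x less in \<open>auto dest: less_asym\<close>)
qed

lemma system_optimum_nth:
  "system_optimum \<tau> \<theta> $ 1 = optimal_share \<theta>"
  "system_optimum \<tau> \<theta> $ 2 = 1 - optimal_share \<theta>"
  by (simp_all add: system_optimum_eq)

lemma system_optimum_in_feasible_flows: "system_optimum \<tau> \<theta> \<in> feasible_flows"
  by (auto simp: feasible_flows_def sum_2 forall_2 system_optimum_nth optimal_share_def)

text \<open>Measurability is read off the closed form.\<close>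

lemma system_optimum_feasible: "feasible_rule (system_optimum \<tau>)"
proof -
  have [measurable]: "optimal_share \<in> borel_measurable state_space"
    unfolding optimal_share_def[abs_def] unconstrained_optimum_def by measurable
  show ?thesis
    unfolding feasible_rule_def forall_2 system_optimum_nth
    using system_optimum_in_feasible_flows by simp
qed

lemma system_optimum_le:
  assumes "x \<in> feasible_flows"
  shows "total_delay \<tau> \<theta> (system_optimum \<tau> \<theta>) \<le> total_delay \<tau> \<theta> x"
proof -
  have "(optimal_share \<theta> - unconstrained_optimum \<theta>)\<^sup>2 \<le> (x $ 1 - unconstrained_optimum \<theta>)\<^sup>2"
    using optimal_share_closest[of "x $ 1" \<theta>] feasible_component[OF assms]
    by (cases "x $ 1 = optimal_share \<theta>") auto
  then have "total_delay \<tau> \<theta> (system_optimum \<tau> \<theta>) - total_delay \<tau> \<theta> x \<le> 0"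
    unfolding total_delay_eq[OF system_optimum_in_feasible_flows assms] system_optimum_nth
    using slope_pos by (intro mult_nonneg_nonpos) auto
  then show ?thesis by simp
qed

text \<open>The pointwise inequality is integrated; this is the lower bound for the cost of every
  competing rule.\<close>

lemma flow_cost_system_optimum_le:
  assumes "feasible_rule g"
  shows "flow_cost M \<Theta> \<tau> (system_optimum \<tau>) \<le> flow_cost M \<Theta> \<tau> g"
  unfolding flow_cost_def using assms state_in_space
  by (intro integral_mono integrable_total_delay system_optimum_feasible system_optimum_le)
    (auto simp: feasible_rule_def)

lemma direct_rule_signaling: "signaling_rule UNIV (direct_rule (system_optimum \<tau>))"
  using system_optimum_feasible
  by (auto simp: signaling_rule_def direct_rule_def feasible_rule_def feasible_flows_def)

section \<open>Obedience to the recommendations is an equilibrium\<close>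

text \<open>At an interior optimum the marginal costs \<open>2 * x / \<alpha> e + t\<close> agree on
  both links. Each equals twice the delay minus the state, so the delays differ by half the
  difference of the states.\<close>

lemma interior_delay_difference:
  assumes "\<And>e. 0 < system_optimum \<tau> \<theta> $ e"
  shows "system_optimum \<tau> \<theta> $ 1 = unconstrained_optimum \<theta>"
    and "\<tau> 1 (\<theta> $ 1) (system_optimum \<tau> \<theta> $ 1) - \<tau> 2 (\<theta> $ 2) (system_optimum \<tau> \<theta> $ 2)
      = (\<theta> $ 1 - \<theta> $ 2) / 2"
proof -
  show *: "system_optimum \<tau> \<theta> $ 1 = unconstrained_optimum \<theta>"
    using assms[of 1] assms[of 2] unfolding system_optimum_nth
    by (auto simp: optimal_share_def max_def min_def split: if_splits)
  have **: "system_optimum \<tau> \<theta> $ 2 = 1 - unconstrained_optimum \<theta>"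
    using * by (simp add: system_optimum_nth)
  show "\<tau> 1 (\<theta> $ 1) (system_optimum \<tau> \<theta> $ 1) - \<tau> 2 (\<theta> $ 2) (system_optimum \<tau> \<theta> $ 2)
      = (\<theta> $ 1 - \<theta> $ 2) / 2"
    using unconstrained_optimum_stationary[of \<theta>] unfolding * ** by (simp add: delay diff_divide_distrib algebra_simps)
qed

lemma induced_flow_obedience:
  "induced_flow UNIV (direct_rule (system_optimum \<tau>)) obedience = system_optimum \<tau>"
  by (rule ext) (simp add: vec_eq_iff induced_flow_def obedience_def direct_rule_def
      if_distrib[of "\<lambda>x. x * _"] cong: if_cong)

lemma obedience_equilibrium:
  assumes interior: "\<And>\<theta> e. \<theta> \<in> measure_support (law M \<Theta>) \<Longrightarrow> 0 < system_optimum \<tau> \<theta> $ e"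
    and balanced: "(\<integral>\<omega>. \<Theta> \<omega> $ 1 - \<Theta> \<omega> $ 2 \<partial>M) = 0"
  shows "bayesian_wardrop_equilibrium M \<Theta> \<tau> UNIV (direct_rule (system_optimum \<tau>)) obedience"
proof -
  define D where "D \<omega> = \<Theta> \<omega> $ 1 - \<Theta> \<omega> $ 2" for \<omega>
  let ?f = "system_optimum \<tau>"
  let ?s = "1 / \<alpha> 1 + 1 / \<alpha> 2"
  let ?c = "message_delay UNIV (direct_rule ?f) obedience"
  have response: "message_response UNIV obedience"
    by (simp add: message_response_def obedience_def)
  note f = feasible_rule_component[OF system_optimum_feasible]
  have D: "integrable M D"
    using state_integrable by (simp add: D_def[abs_def])
  have Df: "integrable M (\<lambda>\<omega>. D \<omega> * ?f (\<Theta> \<omega>) $ m)" for m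
    by (rule integrable_bounded_mult[OF f D])
  \<comment> \<open>Reduces the equilibrium condition to the sign of the expectation of
    \<open>D\<close> times the share of the recommended link.\<close>
  have c: "?c 1 m - ?c 2 m = (\<integral>\<omega>. D \<omega> * ?f (\<Theta> \<omega>) $ m \<partial>M) / 2" for m
  proof -
    have int: "integrable M (\<lambda>\<omega>. \<tau> e (\<Theta> \<omega> $ e) (?f (\<Theta> \<omega>) $ e) * ?f (\<Theta> \<omega>) $ m)" for e
      by (rule integrable_delay_mult[OF system_optimum_feasible f])
    have "?c 1 m - ?c 2 m = (\<integral>\<omega>. \<tau> 1 (\<Theta> \<omega> $ 1) (?f (\<Theta> \<omega>) $ 1) * ?f (\<Theta> \<omega>) $ m
        - \<tau> 2 (\<Theta> \<omega> $ 2) (?f (\<Theta> \<omega>) $ 2) * ?f (\<Theta> \<omega>) $ m \<partial>M)"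
      using int by (simp add: message_delay_def induced_flow_obedience) (simp add: direct_rule_def)
    \<comment> \<open>The half-difference formula holds only at interior optima, hence only almost
      surely.\<close>
    also have "\<dots> = (\<integral>\<omega>. D \<omega> * ?f (\<Theta> \<omega>) $ m / 2 \<partial>M)"
    proof (rule integral_cong_AE)
      show "AE \<omega> in M. \<tau> 1 (\<Theta> \<omega> $ 1) (?f (\<Theta> \<omega>) $ 1) * ?f (\<Theta> \<omega>) $ m
        - \<tau> 2 (\<Theta> \<omega> $ 2) (?f (\<Theta> \<omega>) $ 2) * ?f (\<Theta> \<omega>) $ m = D \<omega> * ?f (\<Theta> \<omega>) $ m / 2"
        using AE_state_in_support
        by eventually_elim
          (simp add: interior interior_delay_difference(2) D_def flip: left_diff_distrib)
    qed (use int Df in auto)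
    finally show ?thesis by simp
  qed
  have ED: "integral\<^sup>L M D = 0"
    using balanced by (simp add: D_def[abs_def])
  \<comment> \<open>The constant \<open>1 / \<alpha> 2 / ?s\<close> is the interior share of link 1
    at \<open>D \<omega> = 0\<close>. The remaining part of the share is a negative multiple of
    \<open>D \<omega>\<close>, so dropping it discards a negative square.\<close>
  have "(\<integral>\<omega>. D \<omega> * ?f (\<Theta> \<omega>) $ 1 \<partial>M) \<le> (\<integral>\<omega>. D \<omega> * (1 / \<alpha> 2 / ?s) \<partial>M)"
  proof (rule integral_mono_AE[OF Df])
    show "integrable M (\<lambda>\<omega>. D \<omega> * (1 / \<alpha> 2 / ?s))"
      using D by simp
    show "AE \<omega> in M. D \<omega> * ?f (\<Theta> \<omega>) $ 1 \<le> D \<omega> * (1 / \<alpha> 2 / ?s)"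
      using AE_state_in_support
    proof eventually_elim
      case (elim \<omega>)
      have "?f (\<Theta> \<omega>) $ 1 = 1 / \<alpha> 2 / ?s - D \<omega> / (2 * ?s)"
      proof -
        have "(2 * u + t - d) / (2 * s) = u / s - (d - t) / (2 * s)" for u d t s :: real
          by (simp add: diff_divide_distrib add_divide_distrib)
        from this[of "1 / \<alpha> 2"] show ?thesis
          by (simp only: interior_delay_difference(1)[OF interior[OF elim]]
              unconstrained_optimum_def D_def mult_1_right times_divide_eq_right)
      qed
      moreover have "0 \<le> D \<omega> * (D \<omega> / (2 * ?s))"
        using slope_pos by simp
      ultimately show ?case by (simp only: right_diff_distrib)
    qed
  qed
  also have "\<dots> = 0"
    using ED D by simp
  finally have le: "(\<integral>\<omega>. D \<omega> * ?f (\<Theta> \<omega>) $ 1 \<partial>M) \<le> 0" .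
  \<comment> \<open>The two shares add up to 1, so the two expectations sum to the mean of
    \<open>D\<close>, which is 0; this settles the second message.\<close>
  have "(\<integral>\<omega>. D \<omega> * ?f (\<Theta> \<omega>) $ 1 \<partial>M) + (\<integral>\<omega>. D \<omega> * ?f (\<Theta> \<omega>) $ 2 \<partial>M)
      = (\<integral>\<omega>. D \<omega> * ?f (\<Theta> \<omega>) $ 1 + D \<omega> * ?f (\<Theta> \<omega>) $ 2 \<partial>M)"
    using Df by simp
  also have "\<dots> = 0"
    using ED by (simp add: system_optimum_nth flip: distrib_left)
  finally have "?c 1 1 \<le> ?c 2 1" "?c 2 2 \<le> ?c 1 2"
    using le c[of 1] c[of 2] by auto
  then show ?thesis
    using response
    by (simp add: bayesian_wardrop_equilibrium_iff direct_rule_signaling forall_2 obedience_def)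
qed

end

theorem corollary3:
  fixes M :: "'w measure"
    and \<Theta> :: "'w \<Rightarrow> real ^ 2"
    and \<tau> :: "2 \<Rightarrow> real \<Rightarrow> real \<Rightarrow> real"
    and \<alpha> :: "2 \<Rightarrow> real"
  assumes "prob_space M"
    and "\<Theta> \<in> measurable M state_space"
    and "\<And>e. integrable M (\<lambda>\<omega>. \<Theta> \<omega> $ e)"
    and "\<And>e. integrable M (\<lambda>\<omega>. (\<Theta> \<omega> $ e)\<^sup>2)"
    and "\<And>e. 0 < \<alpha> e"
    and "\<And>e t x. \<tau> e t x = x / \<alpha> e + t"
    and "\<And>\<theta> e. \<theta> \<in> measure_support (law M \<Theta>) \<Longrightarrow> 0 < system_optimum \<tau> \<theta> $ e"
    and "\<And>i j. (\<integral>\<omega>. \<Theta> \<omega> $ i - \<Theta> \<omega> $ j \<partial>M) = 0"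
  shows "optimal_rule TYPE('n) M \<Theta> \<tau> UNIV (direct_rule (system_optimum \<tau>)) \<and>
    (\<forall>y. bayesian_wardrop_equilibrium M \<Theta> \<tau> UNIV (direct_rule (system_optimum \<tau>)) y \<longrightarrow>
      flow_cost M \<Theta> \<tau> (induced_flow UNIV (direct_rule (system_optimum \<tau>)) y)
        = flow_cost M \<Theta> \<tau> (system_optimum \<tau>))"
proof -
  interpret prob_space M by fact
  interpret affine_two_links M \<Theta> \<tau> \<alpha>
    by unfold_locales (use assms in auto)
  have obey: "bayesian_wardrop_equilibrium M \<Theta> \<tau> UNIV (direct_rule (system_optimum \<tau>)) obedience"
    using assms(7,8) by (rule obedience_equilibrium)
  \<comment> \<open>All equilibria of the rule have the same cost, and the obedient one induces the
    system optimum itself.\<close>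
  have cost: "flow_cost M \<Theta> \<tau> (induced_flow UNIV (direct_rule (system_optimum \<tau>)) y)
        = flow_cost M \<Theta> \<tau> (system_optimum \<tau>)"
    if "bayesian_wardrop_equilibrium M \<Theta> \<tau> UNIV (direct_rule (system_optimum \<tau>)) y" for y
    using equilibrium_cost_unique[OF direct_rule_signaling that obey]
    by (simp add: induced_flow_obedience)
  have "flow_cost M \<Theta> \<tau> (system_optimum \<tau>) \<le> flow_cost M \<Theta> \<tau> (induced_flow Msg \<pi> y)"
    if "signaling_rule Msg \<pi>" "bayesian_wardrop_equilibrium M \<Theta> \<tau> Msg \<pi> y"
    for Msg :: "'n set" and \<pi> y
    using that by (intro flow_cost_system_optimum_le induced_flow_feasible)
      (auto simp: bayesian_wardrop_equilibrium_def)
  then show ?thesis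
    unfolding optimal_rule_def using direct_rule_signaling obey cost by auto
qed

end
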